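(* Consider biased SGD, $x_{k+1}=x_k-\alpha_k(u_k+e_k)$ with $u_k=\nabla f_{i_k}(x_k)$ and $\|e_k\|^2\le\delta^2\|u_k\|^2+c^2$, applied to $g=\frac1n\sum_{i=1}^n f_i$ with $g\in\mathcal{S}(m,\infty)$ for some $m>0$, and let $x_\star$ be the unique global minimizer of $g$. Suppose that one of the four conditions I–IV on the $f_i$ listed in the context holds, with corresponding $M$ and $G$, and put $\tilde M=M_{11}+2mM_{12}$. Assume further that $\alpha_k=\alpha>0$ for all $k$ (constant stepsize) and that $M_{21}\left(\alpha+\frac{\delta^2}{m}\right)\le1$. Finally, assume that $$0<\tilde\rho^2<1,\quad\text{where}\quad\tilde\rho^2=1-\tfrac{m^2-\tilde M\delta^2}{m}\alpha+\bigl(\tilde M(1+\delta^2)-2m^2\bigr)\alpha^2+\tilde Mm\alpha^3 .$$ Note that the condition $0<\tilde\rho^2<1$ holds for $\alpha$ sufficiently small. Then the iterates satisfy the error bound $$\mathbb{E}\|x_k-x_\star\|^2\le\tilde\rho^{2k}\,\mathbb{E}\|x_0-x_\star\|^2+\tilde U_\star,$$ where $$\tilde U_\star=\frac{2\delta^2G^2+c^2+m\bigl(c^2+2G^2(1+\delta^2)\bigr)\alpha+2m^2G^2\alpha^2}{(m^2-\tilde M\delta^2)-m\bigl(\tilde M(1+\delta^2)-2m^2\bigr)\alpha-\tilde Mm^2\alpha^2}.$$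
   Context: Setting. $p,n\ge1$ are integers, $f_1,\dots,f_n:\mathbb{R}^p\to\mathbb{R}$ are differentiable, and $g(x)=\frac1n\sum_{i=1}^n f_i(x)$. For $m>0$, $g\in\mathcal{S}(m,\infty)$ means that $g$ is differentiable, has a global minimizer $x_\star$, and $(x-x_\star)^{\mathsf T}\nabla g(x)\ge m\|x-x_\star\|^2$ for all $x\in\mathbb{R}^p$ (hence $x_\star$ is the unique minimizer and unique stationary point). Biased SGD. $x_{k+1}=x_k-\alpha_k(u_k+e_k)$ with $u_k=\nabla f_{i_k}(x_k)$ and stepsizes $\alpha_k$. The indices $i_k$ are IID uniform on $\{1,\dots,n\}$ and $i_k$ is independent of $x_k$. The errors $e_k$ are otherwise arbitrary (random, set in advance, or adversarial) but satisfy $\|e_k\|^2\le\delta^2\|u_k\|^2+c^2$ for every $k$, where $\delta,c\ge0$ are fixed known constants. Function class. For $0\le m\le L$, $0<L<\infty$, $\mathcal{F}(m,L)$ is the set of differentiable $f:\mathbb{R}^p\to\mathbb{R}$ with $-2m\|x-y\|^2+2(1+\frac mL)(x-y)^{\mathsf T}(\nabla f(x)-\nabla f(y))-\frac2L\|\nabla f(x)-\nabla f(y)\|^2\ge0$ for all $x,y$. $\mathcal{F}(0,L)$ is the class of convex $L$-smooth functions. A differentiable $f$ is $L$-smooth if $\|\nabla f(x)-\nabla f(y)\|\le L\|x-y\|$ for all $x,y$. The four cases (each condition is required for every $i$; $m$ is the same as in $g\in\mathcal{S}(m,\infty)$): I. $\|\nabla f_i(x)-mx\|\le\beta$ for all $x$;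 $M=\begin{bmatrix} -m^2 & m \\ m & -1 \end{bmatrix}$, $G^2=\beta^2+m^2\|x_\star\|^2$. II. $f_i$ is $L$-smooth (not necessarily convex); $M=\begin{bmatrix} 2L^2 & 0 \\ 0 & -1 \end{bmatrix}$, $G^2=\frac1n\sum_{i=1}^n\|\nabla f_i(x_\star)\|^2$. III. $f_i\in\mathcal{F}(0,L)$; $M=\begin{bmatrix} 0 & L \\ L & -1 \end{bmatrix}$, $G^2=\frac1n\sum_{i=1}^n\|\nabla f_i(x_\star)\|^2$. IV. $f_i\in\mathcal{F}(m,L)$; $M=\begin{bmatrix} -2mL & L+m \\ L+m & -1 \end{bmatrix}$, $G^2=\frac1n\sum_{i=1}^n\|\nabla f_i(x_\star)\|^2$. Here $M_{ij}$ are the entries of $M$.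
   Formalization: The remark that 0<ρ̃²<1 holds for small α is proved only under the corollary's assumptions, including ρ̃²<1 at the given α; without that it fails, e.g. in case II with f=x²/2, m=L=1, δ=1, where ρ̃²>1 for every α>0. *)

theory Defs
  imports "HOL-Probability.Probability"
begin

definition grad :: "('a::euclidean_space \<Rightarrow> real) \<Rightarrow> 'a \<Rightarrow> 'a" where
  "grad f x = (THE d. GDERIV f x :> d)"

lemma GDERIV_grad:
  fixes f :: "'a::euclidean_space \<Rightarrow> real"
  assumes "f differentiable (at x)"
  shows "GDERIV f x :> grad f x"
proof -
  obtain D where D: "(f has_derivative D) (at x)"
    using assms unfolding differentiable_def by blast
  have "linear D"
    by (rule has_derivative_linear[OF D])
  then have "D = (\<lambda>h. h \<bullet> adjoint D 1)"
    using adjoint_works[of D _ 1] by (simp add: fun_eq_iff)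
  then have ex: "GDERIV f x :> adjoint D 1"
    using D unfolding gderiv_def by simp
  have "d = adjoint D 1" if "GDERIV f x :> d" for d
  proof -
    have "(\<lambda>h. h \<bullet> d) = (\<lambda>h. h \<bullet> adjoint D 1)"
      using has_derivative_unique[OF that[unfolded gderiv_def] ex[unfolded gderiv_def]] .
    then show ?thesis
      using vector_eq_ldot[of d "adjoint D 1"] by (simp add: fun_eq_iff)
  qed
  with ex show ?thesis
    unfolding grad_def by (rule theI)
qed

text \<open>The class \<open>\<S>(m, \<infinity>)\<close>.\<close>

definition class_S :: "real \<Rightarrow> ('a::euclidean_space \<Rightarrow> real) set" where
  "class_S m = {g. (\<forall>x. g differentiable (at x)) \<and>
     (\<exists>xs. (\<forall>x. g xs \<le> g x) \<and> (\<forall>x. (x - xs) \<bullet> grad g x \<ge> m * (norm (x - xs))\<^sup>2))}"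

definition class_F :: "real \<Rightarrow> real \<Rightarrow> ('a::euclidean_space \<Rightarrow> real) set" where
  "class_F m L = {f. 0 \<le> m \<and> m \<le> L \<and> 0 < L \<and> (\<forall>x. f differentiable (at x)) \<and>
     (\<forall>x y. - 2 * m * (norm (x - y))\<^sup>2
        + 2 * (1 + m / L) * ((x - y) \<bullet> (grad f x - grad f y))
        - 2 / L * (norm (grad f x - grad f y))\<^sup>2 \<ge> 0)}"

definition L_smooth :: "real \<Rightarrow> ('a::euclidean_space \<Rightarrow> real) \<Rightarrow> bool" where
  "L_smooth L f \<longleftrightarrow> (\<forall>x. f differentiable (at x)) \<and>
     (\<forall>x y. norm (grad f x - grad f y) \<le> L * norm (x - y))"

definition avg :: "nat \<Rightarrow> (nat \<Rightarrow> 'a \<Rightarrow> real) \<Rightarrow> 'a \<Rightarrow> real" where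
  "avg n f x = (1 / real n) * (\<Sum>i=1..n. f i x)"

definition mat22 :: "real \<Rightarrow> real \<Rightarrow> real \<Rightarrow> real \<Rightarrow> real^2^2" where
  "mat22 a b c d = vector [vector [a, b], vector [c, d]]"

text \<open>In the four cases below, \<open>M\<close> and \<open>G\<close> are the matrix and the constant
  that go with the condition on \<open>f\<^sub>1, \<dots>, f\<^sub>n\<close>, and \<open>xs\<close> stands for the minimizer.\<close>

definition case_I ::
  "nat \<Rightarrow> (nat \<Rightarrow> 'a::euclidean_space \<Rightarrow> real) \<Rightarrow> real \<Rightarrow> 'a \<Rightarrow> real^2^2 \<Rightarrow> real \<Rightarrow> bool" where
  "case_I n f m xs M G \<longleftrightarrow>
     (\<exists>\<beta>. (\<forall>i\<in>{1..n}. \<forall>x. norm (grad (f i) x - m *\<^sub>R x) \<le> \<beta>) \<and>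
       M = mat22 (- m\<^sup>2) m m (- 1) \<and> G\<^sup>2 = \<beta>\<^sup>2 + m\<^sup>2 * (norm xs)\<^sup>2)"

definition case_II ::
  "nat \<Rightarrow> (nat \<Rightarrow> 'a::euclidean_space \<Rightarrow> real) \<Rightarrow> 'a \<Rightarrow> real^2^2 \<Rightarrow> real \<Rightarrow> bool" where
  "case_II n f xs M G \<longleftrightarrow>
     (\<exists>L. (\<forall>i\<in>{1..n}. L_smooth L (f i)) \<and>
       M = mat22 (2 * L\<^sup>2) 0 0 (- 1) \<and>
       G\<^sup>2 = (1 / real n) * (\<Sum>i=1..n. (norm (grad (f i) xs))\<^sup>2))"

definition case_III ::
  "nat \<Rightarrow> (nat \<Rightarrow> 'a::euclidean_space \<Rightarrow> real) \<Rightarrow> 'a \<Rightarrow> real^2^2 \<Rightarrow> real \<Rightarrow> bool" where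
  "case_III n f xs M G \<longleftrightarrow>
     (\<exists>L. (\<forall>i\<in>{1..n}. f i \<in> class_F 0 L) \<and>
       M = mat22 0 L L (- 1) \<and>
       G\<^sup>2 = (1 / real n) * (\<Sum>i=1..n. (norm (grad (f i) xs))\<^sup>2))"

definition case_IV ::
  "nat \<Rightarrow> (nat \<Rightarrow> 'a::euclidean_space \<Rightarrow> real) \<Rightarrow> real \<Rightarrow> 'a \<Rightarrow> real^2^2 \<Rightarrow> real \<Rightarrow> bool" where
  "case_IV n f m xs M G \<longleftrightarrow>
     (\<exists>L. (\<forall>i\<in>{1..n}. f i \<in> class_F m L) \<and>
       M = mat22 (- 2 * m * L) (L + m) (L + m) (- 1) \<and>
       G\<^sup>2 = (1 / real n) * (\<Sum>i=1..n. (norm (grad (f i) xs))\<^sup>2))"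

text \<open>Independence of two random variables. The library's \<open>indep_var\<close> forces both to
  have the same value type, which does not fit an index and a vector.\<close>

definition (in prob_space) indep_rvs ::
  "'b measure \<Rightarrow> ('a \<Rightarrow> 'b) \<Rightarrow> 'c measure \<Rightarrow> ('a \<Rightarrow> 'c) \<Rightarrow> bool" where
  "indep_rvs S X T Y \<longleftrightarrow> random_variable S X \<and> random_variable T Y \<and>
     indep_set {X -` A \<inter> space M | A. A \<in> sets S} {Y -` B \<inter> space M | B. B \<in> sets T}"

text \<open>Nothing is assumed about how the errors \<open>e\<close> depend on the other random
  quantities, beyond the norm bound.\<close>

definition (in prob_space) biased_sgd ::
  "nat \<Rightarrow> (nat \<Rightarrow> 'b::euclidean_space \<Rightarrow> real) \<Rightarrow> real \<Rightarrow> real \<Rightarrow> (nat \<Rightarrow> real) \<Rightarrow>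
   (nat \<Rightarrow> 'a \<Rightarrow> nat) \<Rightarrow> (nat \<Rightarrow> 'a \<Rightarrow> 'b) \<Rightarrow> (nat \<Rightarrow> 'a \<Rightarrow> 'b) \<Rightarrow> bool" where
  "biased_sgd n f \<delta> c \<alpha> i e x \<longleftrightarrow>
     indep_vars (\<lambda>_. count_space {1..n}) i UNIV \<and>
     (\<forall>k. distr M (count_space {1..n}) (i k) = uniform_count_measure {1..n}) \<and>
     (\<forall>k. random_variable borel (x k)) \<and>
     (\<forall>k. random_variable borel (e k)) \<and>
     (\<forall>k. indep_rvs (count_space {1..n}) (i k) borel (x k)) \<and>
     (\<forall>k. \<forall>\<omega>\<in>space M.
        let u = grad (f (i k \<omega>)) (x k \<omega>) in
          x (Suc k) \<omega> = x k \<omega> - \<alpha> k *\<^sub>R (u + e k \<omega>) \<and>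
          (norm (e k \<omega>))\<^sup>2 \<le> \<delta>\<^sup>2 * (norm u)\<^sup>2 + c\<^sup>2)"

definition M_tilde :: "real \<Rightarrow> real^2^2 \<Rightarrow> real" where
  "M_tilde m M = M $ 1 $ 1 + 2 * m * M $ 1 $ 2"

text \<open>\<open>rho_sq\<close> is \<open>\<rho>\<^sup>2\<close> itself, so that \<open>\<rho>\<^bsup>2k\<^esup>\<close> is its \<open>k\<close>-th power.\<close>

definition rho_sq :: "real \<Rightarrow> real \<Rightarrow> real \<Rightarrow> real \<Rightarrow> real" where
  "rho_sq m Mt \<delta> \<alpha> =
     1 - (m\<^sup>2 - Mt * \<delta>\<^sup>2) / m * \<alpha> + (Mt * (1 + \<delta>\<^sup>2) - 2 * m\<^sup>2) * \<alpha>\<^sup>2 + Mt * m * \<alpha> ^ 3"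

definition U_star :: "real \<Rightarrow> real \<Rightarrow> real \<Rightarrow> real \<Rightarrow> real \<Rightarrow> real \<Rightarrow> real" where
  "U_star m Mt G \<delta> c \<alpha> =
     (2 * \<delta>\<^sup>2 * G\<^sup>2 + c\<^sup>2 + m * (c\<^sup>2 + 2 * G\<^sup>2 * (1 + \<delta>\<^sup>2)) * \<alpha> + 2 * m\<^sup>2 * G\<^sup>2 * \<alpha>\<^sup>2) /
     ((m\<^sup>2 - Mt * \<delta>\<^sup>2) - m * (Mt * (1 + \<delta>\<^sup>2) - 2 * m\<^sup>2) * \<alpha> - Mt * m\<^sup>2 * \<alpha>\<^sup>2)"

end

theory Submission
  imports Defs
begin

text \<open>Write \<open>d = x\<^sub>k - x\<^sub>\<star>\<close> and let \<open>u\<^sub>j\<close> be the gradient of \<open>f\<^sub>j\<close> at \<open>x\<^sub>k\<close>. Young's inequality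
  bounds the squared distance after one step by a quadratic expression in \<open>(d, u\<^sub>j)\<close> that no longer
  involves the error. Since \<open>i\<^sub>k\<close> is uniform and independent of \<open>x\<^sub>k\<close>, the expectation of this
  bound equals that of its average over \<open>j\<close>. In each of the four cases the mean of the
  \<open>|u\<^sub>j|\<^sup>2\<close> is at most \<open>M\<^sub>1\<^sub>1 |d|\<^sup>2 + 2 M\<^sub>1\<^sub>2 \<langle>d, \<nabla>g\<rangle> + 2 G\<^sup>2\<close>. After this substitution the
  stepsize condition says precisely that \<open>\<langle>d, \<nabla>g\<rangle>\<close> has a nonpositive coefficient, so that
  \<open>\<langle>d, \<nabla>g\<rangle> \<ge> m |d|\<^sup>2\<close> may be used, and the coefficient of \<open>|d|\<^sup>2\<close> factors into
  \<open>rho_sq\<close>. The resulting affine recursion has fixed point \<open>U_star\<close>.\<close>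

section \<open>Gradients: averages, minimizers, measurability\<close>

lemma GDERIV_imp_grad:
  fixes f :: "'a::euclidean_space \<Rightarrow> real"
  assumes "GDERIV f x :> d"
  shows "grad f x = d"
proof -
  have "f differentiable (at x)"
    using assms unfolding gderiv_def differentiable_def by blast
  from has_derivative_unique[OF GDERIV_grad[OF this, unfolded gderiv_def] assms[unfolded gderiv_def]]
  show ?thesis
    using vector_eq_ldot[of "grad f x" d] by (simp add: fun_eq_iff)
qed

lemma grad_avg:
  fixes f :: "nat \<Rightarrow> 'a::euclidean_space \<Rightarrow> real"
  assumes "\<And>j. j \<in> {1..n} \<Longrightarrow> f j differentiable (at x)"
  shows "grad (avg n f) x = (1 / real n) *\<^sub>R (\<Sum>j=1..n. grad (f j) x)"
proof (rule GDERIV_imp_grad)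
  have "((\<lambda>y. (1 / real n) * (\<Sum>j=1..n. f j y)) has_derivative
      (\<lambda>h. (1 / real n) * (\<Sum>j=1..n. h \<bullet> grad (f j) x))) (at x)"
    using GDERIV_grad[OF assms] unfolding gderiv_def
    by (intro has_derivative_mult_right has_derivative_sum) auto
  then show "GDERIV (avg n f) x :> (1 / real n) *\<^sub>R (\<Sum>j=1..n. grad (f j) x)"
    unfolding gderiv_def avg_def[abs_def] by (simp add: inner_sum_right)
qed

lemma grad_eq_0_at_minimum:
  fixes g :: "'a::euclidean_space \<Rightarrow> real"
  assumes "g differentiable (at z)" and "\<And>y. g z \<le> g y"
  shows "grad g z = 0"
proof -
  have "(\<lambda>h. h \<bullet> grad g z) = (\<lambda>h. 0)"
    using GDERIV_grad[OF assms(1)] assms(2) unfolding gderiv_def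
    by (intro differential_zero_maxmin[of z UNIV g]) auto
  then have "grad g z \<bullet> grad g z = 0"
    by (rule fun_cong)
  then show ?thesis by simp
qed

text \<open>\<open>class_S\<close> quantifies over its own minimizer \<open>w\<close>. Since
  \<open>grad g z\<close> vanishes at any minimizer \<open>z\<close>, the inequality around
  \<open>w\<close>, taken at \<open>z\<close>, forces \<open>w = z\<close>, so it may be used around
  the given point.\<close>

lemma class_S_minimizer:
  fixes g :: "'a::euclidean_space \<Rightarrow> real"
  assumes "m > 0" "g \<in> class_S m" and min: "\<And>y. g z \<le> g y"
  shows "(y - z) \<bullet> grad g y \<ge> m * (norm (y - z))\<^sup>2"
proof -
  obtain w where w: "\<And>y. (y - w) \<bullet> grad g y \<ge> m * (norm (y - w))\<^sup>2"
    and diff: "\<And>y. g differentiable (at y)"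
    using assms(2) unfolding class_S_def by blast
  have "m * (norm (z - w))\<^sup>2 \<le> 0"
    using w[of z] grad_eq_0_at_minimum[OF diff min] by simp
  then have "w = z"
    using \<open>m > 0\<close> by (simp add: mult_le_0_iff)
  with w show ?thesis by simp
qed

text \<open>In case I the gradients may be discontinuous. They are still limits of difference
  quotients of a continuous function, coordinate by coordinate.\<close>

lemma grad_borel_measurable:
  fixes f :: "'a::euclidean_space \<Rightarrow> real"
  assumes diff: "\<And>y. f differentiable (at y)"
  shows "grad f \<in> borel_measurable borel"
proof (subst borel_measurable_euclidean_space, intro ballI)
  fix b :: 'a assume "b \<in> Basis"
  have "continuous_on UNIV f"
    using diff by (intro continuous_at_imp_continuous_on) (auto intro: differentiable_imp_continuous_within)
  then have meas: "f \<in> borel_measurable borel"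
    by (rule borel_measurable_continuous_onI)
  show "(\<lambda>y. grad f y \<bullet> b) \<in> borel_measurable borel"
  proof (rule borel_measurable_LIMSEQ_real)
    fix y :: 'a
    have "((\<lambda>t::real. y + t *\<^sub>R b) has_derivative (\<lambda>t. t *\<^sub>R b)) (at 0)"
      by (auto intro!: derivative_eq_intros)
    moreover have "(f has_derivative (\<lambda>h. h \<bullet> grad f y)) (at (y + (0::real) *\<^sub>R b))"
      using GDERIV_grad[OF diff[of y]] unfolding gderiv_def by simp
    ultimately have "((\<lambda>t. f (y + t *\<^sub>R b)) has_derivative (\<lambda>t. (t *\<^sub>R b) \<bullet> grad f y)) (at 0)"
      by (rule has_derivative_compose)
    then have "((\<lambda>t. f (y + t *\<^sub>R b)) has_field_derivative (grad f y \<bullet> b)) (at 0)"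
      by (rule has_derivative_imp_has_field_derivative) (simp add: inner_commute)
    then have lim: "((\<lambda>t. (f (y + t *\<^sub>R b) - f y) / t) \<longlongrightarrow> grad f y \<bullet> b) (at 0)"
      by (simp add: has_field_derivative_iff)
    \<comment> \<open>Measurability passes to limits of sequences, so the limit at 0 is read along
      the nonzero increments \<open>1 / (k + 1)\<close>.\<close>
    have "filterlim (\<lambda>k. inverse (real (Suc k))) (at 0) sequentially"
      unfolding filterlim_at using LIMSEQ_inverse_real_of_nat by auto
    from filterlim_compose[OF lim this]
    show "(\<lambda>k. (f (y + inverse (real (Suc k)) *\<^sub>R b) - f y) / inverse (real (Suc k)))
        \<longlonglongrightarrow> grad f y \<bullet> b" .
  next
    fix k
    show "(\<lambda>y. (f (y + inverse (real (Suc k)) *\<^sub>R b) - f y) / inverse (real (Suc k)))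
        \<in> borel_measurable borel"
      using meas by measurable
  qed
qed

section \<open>Expectation over an independent uniform index\<close>

lemma (in prob_space) nn_integral_indicator_indep:
  assumes X: "X \<in> measurable M S" and h: "h \<in> borel_measurable S" and A: "A \<in> events"
    and indep: "\<And>B. B \<in> sets S \<Longrightarrow> prob (A \<inter> (X -` B \<inter> space M)) = prob A * prob (X -` B \<inter> space M)"
  shows "(\<integral>\<^sup>+\<omega>. indicator A \<omega> * h (X \<omega>) \<partial>M) = ennreal (prob A) * (\<integral>\<^sup>+\<omega>. h (X \<omega>) \<partial>M)"
proof -
  \<comment> \<open>Independence in terms of laws: restricting to \<open>A\<close> before pushing
    forward along \<open>X\<close> only rescales the law of \<open>X\<close>. Integrating
    \<open>h\<close> against both measures gives the claim.\<close>
  have "distr (density M (indicator A)) S X = scale_measure (ennreal (prob A)) (distr M S X)"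
  proof (rule measure_eqI)
    fix B assume "B \<in> sets (distr (density M (indicator A)) S X)"
    then have B: "B \<in> sets S" by simp
    then have XB: "X -` B \<inter> space M \<in> events"
      using X by (rule measurable_sets[rotated])
    have "emeasure (density M (indicator A)) (X -` B \<inter> space M) = emeasure M (A \<inter> (X -` B \<inter> space M))"
      using A XB by (simp add: emeasure_density indicator_inter_arith[symmetric])
    then show "emeasure (distr (density M (indicator A)) S X) B
        = emeasure (scale_measure (ennreal (prob A)) (distr M S X)) B"
      using indep[OF B] B X by (simp add: emeasure_distr emeasure_eq_measure ennreal_mult)
  qed simp
  then have "(\<integral>\<^sup>+y. h y \<partial>distr (density M (indicator A)) S X)
      = (\<integral>\<^sup>+y. h y \<partial>scale_measure (ennreal (prob A)) (distr M S X))"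
    by simp
  then show ?thesis
    using X h A by (simp add: nn_integral_distr nn_integral_scale_measure nn_integral_density)
qed

text \<open>Splitting over the events \<open>I = j\<close> leaves a fixed function of
  \<open>X\<close> on each of them; independence then pulls out the probability
  \<open>1 / n\<close>.\<close>

lemma (in prob_space) nn_integral_uniform_index:
  fixes I :: "'a \<Rightarrow> nat" and h :: "nat \<Rightarrow> 'b \<Rightarrow> ennreal"
  assumes "n \<ge> 1" and ind: "indep_rvs (count_space {1..n}) I S X"
    and unif: "distr M (count_space {1..n}) I = uniform_count_measure {1..n}"
    and h: "\<And>j. j \<in> {1..n} \<Longrightarrow> h j \<in> borel_measurable S"
  shows "(\<integral>\<^sup>+\<omega>. h (I \<omega>) (X \<omega>) \<partial>M) = (\<integral>\<^sup>+\<omega>. ennreal (1 / real n) * (\<Sum>j=1..n. h j (X \<omega>)) \<partial>M)"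
proof -
  have I: "I \<in> measurable M (count_space {1..n})" and X: "X \<in> measurable M S"
    and indep: "indep_set {I -` A \<inter> space M | A. A \<in> sets (count_space {1..n})}
      {X -` B \<inter> space M | B. B \<in> sets S}"
    using ind unfolding indep_rvs_def by auto
  define A where "A j = I -` {j} \<inter> space M" for j
  have A: "A j \<in> events" if "j \<in> {1..n}" for j
    using I that unfolding A_def by (auto intro: measurable_sets)
  have probA: "prob (A j) = 1 / real n" if "j \<in> {1..n}" for j
  proof -
    have "prob (A j) = measure (distr M (count_space {1..n}) I) {j}"
      using that I by (simp add: measure_distr A_def)
    also have "\<dots> = 1 / real n"
      using that unfolding unif by (simp add: measure_uniform_count_measure)
    finally show ?thesis .
  qed
  have "(\<integral>\<^sup>+\<omega>. h (I \<omega>) (X \<omega>) \<partial>M) = (\<integral>\<^sup>+\<omega>. (\<Sum>j=1..n. indicator (A j) \<omega> * h j (X \<omega>)) \<partial>M)"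
  proof (rule nn_integral_cong)
    fix \<omega> assume \<omega>: "\<omega> \<in> space M"
    then have "I \<omega> \<in> {1..n}"
      using measurable_space[OF I] by simp
    then have "h (I \<omega>) (X \<omega>) = (\<Sum>j=1..n. if I \<omega> = j then h j (X \<omega>) else 0)"
      by (simp add: sum.delta')
    also have "\<dots> = (\<Sum>j=1..n. indicator (A j) \<omega> * h j (X \<omega>))"
      using \<omega> by (intro sum.cong) (auto simp: A_def indicator_def)
    finally show "h (I \<omega>) (X \<omega>) = (\<Sum>j=1..n. indicator (A j) \<omega> * h j (X \<omega>))" .
  qed
  also have "\<dots> = (\<Sum>j=1..n. \<integral>\<^sup>+\<omega>. indicator (A j) \<omega> * h j (X \<omega>) \<partial>M)"
    using A measurable_compose[OF X h] by (intro nn_integral_sum) simp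
  also have "\<dots> = (\<Sum>j=1..n. ennreal (1 / real n) * (\<integral>\<^sup>+\<omega>. h j (X \<omega>) \<partial>M))"
  proof (rule sum.cong)
    fix j assume j: "j \<in> {1..n}"
    have "(\<integral>\<^sup>+\<omega>. indicator (A j) \<omega> * h j (X \<omega>) \<partial>M) = ennreal (prob (A j)) * (\<integral>\<^sup>+\<omega>. h j (X \<omega>) \<partial>M)"
    proof (rule nn_integral_indicator_indep[OF X h[OF j] A[OF j]])
      fix B assume "B \<in> sets S"
      with j show "prob (A j \<inter> (X -` B \<inter> space M)) = prob (A j) * prob (X -` B \<inter> space M)"
        by (intro indep_setD[OF indep]) (auto simp: A_def intro!: exI[of _ "{j}"])
    qed
    then show "(\<integral>\<^sup>+\<omega>. indicator (A j) \<omega> * h j (X \<omega>) \<partial>M) = ennreal (1 / real n) * (\<integral>\<^sup>+\<omega>. h j (X \<omega>) \<partial>M)"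
      using probA[OF j] by simp
  qed simp
  also have "\<dots> = (\<integral>\<^sup>+\<omega>. ennreal (1 / real n) * (\<Sum>j=1..n. h j (X \<omega>)) \<partial>M)"
    unfolding sum_distrib_left using measurable_compose[OF X h]
    by (subst nn_integral_sum) (auto intro!: sum.cong nn_integral_cmult[symmetric])
  finally show ?thesis .
qed

section \<open>The mean squared gradient in the four cases\<close>

lemma norm_sq_le_2_diff_sq:
  fixes u v :: "'a::real_inner"
  shows "(norm u)\<^sup>2 \<le> 2 * (norm (u - v))\<^sup>2 + 2 * (norm v)\<^sup>2"
proof -
  \<comment> \<open>This square is exactly the right side minus the left side.\<close>
  have "0 \<le> (norm (u - 2 *\<^sub>R v))\<^sup>2" by simp
  then show ?thesis
    unfolding power2_norm_eq_inner by (simp add: algebra_simps inner_commute)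
qed

text \<open>This is the defining inequality of \<open>class_F\<close> multiplied by
  \<open>L / 2\<close>. It serves case III with \<open>\<mu> = 0\<close> and case IV with
  \<open>\<mu> = m\<close>.\<close>

lemma class_F_cocoercive:
  fixes f :: "'a::euclidean_space \<Rightarrow> real"
  assumes "f \<in> class_F \<mu> L"
  shows "(norm (grad f y - grad f z))\<^sup>2
    \<le> (L + \<mu>) * ((y - z) \<bullet> (grad f y - grad f z)) - \<mu> * L * (norm (y - z))\<^sup>2"
proof -
  have L: "L > 0"
    and "- 2 * \<mu> * (norm (y - z))\<^sup>2 + 2 * (1 + \<mu> / L) * ((y - z) \<bullet> (grad f y - grad f z))
        - 2 / L * (norm (grad f y - grad f z))\<^sup>2 \<ge> 0"
    using assms unfolding class_F_def by auto
  from mult_nonneg_nonneg[OF less_imp_le[OF L] this(2)] L show ?thesis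
    by (simp add: distrib_left distrib_right right_diff_distrib mult.assoc[symmetric])
      (simp add: mult_ac)
qed

text \<open>The averaging shared by the four cases. The reference vectors \<open>v j\<close> sum to
  zero and so disappear from the mean: they are 0 in case I and the gradients at the minimizer in
  the others.\<close>

lemma mean_sq_grad_le_of_pointwise:
  fixes f :: "nat \<Rightarrow> 'a::euclidean_space \<Rightarrow> real" and v :: "nat \<Rightarrow> 'a"
  assumes n: "n \<ge> 1" and diff: "\<And>j y. j \<in> {1..n} \<Longrightarrow> f j differentiable (at y)"
    and v: "(\<Sum>j=1..n. v j) = 0"
    and bound: "\<And>j. j \<in> {1..n} \<Longrightarrow> (norm (grad (f j) y))\<^sup>2
      \<le> a * (norm (y - z))\<^sup>2 + 2 * b * ((y - z) \<bullet> (grad (f j) y - v j)) + 2 * w j"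
  shows "(1 / real n) * (\<Sum>j=1..n. (norm (grad (f j) y))\<^sup>2)
    \<le> a * (norm (y - z))\<^sup>2 + 2 * b * ((y - z) \<bullet> grad (avg n f) y)
      + 2 * ((1 / real n) * (\<Sum>j=1..n. w j))"
proof -
  have grad: "grad (avg n f) x = (1 / real n) *\<^sub>R (\<Sum>j=1..n. grad (f j) x)" for x
    using diff by (rule grad_avg)
  have "(\<Sum>j=1..n. (norm (grad (f j) y))\<^sup>2)
      \<le> (\<Sum>j=1..n. a * (norm (y - z))\<^sup>2 + 2 * b * ((y - z) \<bullet> (grad (f j) y - v j)) + 2 * w j)"
    using bound by (intro sum_mono) auto
  also have "\<dots> = real n * (a * (norm (y - z))\<^sup>2)
      + 2 * b * ((y - z) \<bullet> (\<Sum>j=1..n. grad (f j) y)) + 2 * (\<Sum>j=1..n. w j)"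
    using v by (simp add: sum.distrib sum_distrib_left[symmetric] inner_sum_right[symmetric] sum_subtractf)
  finally have "(1 / real n) * (\<Sum>j=1..n. (norm (grad (f j) y))\<^sup>2)
      \<le> (1 / real n) * (real n * (a * (norm (y - z))\<^sup>2)
      + 2 * b * ((y - z) \<bullet> (\<Sum>j=1..n. grad (f j) y)) + 2 * (\<Sum>j=1..n. w j))"
    by (intro mult_left_mono) auto
  also have "\<dots> = a * (norm (y - z))\<^sup>2 + 2 * b * ((y - z) \<bullet> grad (avg n f) y)
      + 2 * ((1 / real n) * (\<Sum>j=1..n. w j))"
    using n unfolding grad by (simp add: field_simps)
  finally show ?thesis .
qed

lemma mat22_nth [simp]:
  "mat22 a b c d $ 1 $ 1 = a" "mat22 a b c d $ 1 $ 2 = b" "mat22 a b c d $ 2 $ 1 = c"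
  by (simp_all add: mat22_def)

text \<open>In cases II to IV each gradient is split into its value at \<open>z\<close> and its
  change from there. The factor 2 of this split appears in \<open>2 * G\<^sup>2\<close> and doubles
  the smoothness or cocoercivity bound into the entries of \<open>M\<close>.\<close>

lemma mean_sq_grad_le:
  fixes f :: "nat \<Rightarrow> 'a::euclidean_space \<Rightarrow> real"
  assumes n: "n \<ge> 1" and diff: "\<And>j y. j \<in> {1..n} \<Longrightarrow> f j differentiable (at y)"
    and stat: "grad (avg n f) z = 0"
    and cases: "case_I n f m z M G \<or> case_II n f z M G \<or> case_III n f z M G \<or> case_IV n f m z M G"
  shows "(1 / real n) * (\<Sum>j=1..n. (norm (grad (f j) y))\<^sup>2)
    \<le> M $ 1 $ 1 * (norm (y - z))\<^sup>2 + 2 * M $ 1 $ 2 * ((y - z) \<bullet> grad (avg n f) y) + 2 * G\<^sup>2"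
proof -
  have grad: "grad (avg n f) x = (1 / real n) *\<^sub>R (\<Sum>j=1..n. grad (f j) x)" for x
    using diff by (rule grad_avg)
  have sum0: "(\<Sum>j=1..n. grad (f j) z) = 0"
    using stat n unfolding grad by simp
  note pointwise = mean_sq_grad_le_of_pointwise[where f = f and y = y and z = z, OF n diff]
  note split = norm_sq_le_2_diff_sq[of "grad (f j) y" "grad (f j) z" for j]
  from cases show ?thesis
  proof (elim disjE)
    assume "case_I n f m z M G"
    then obtain \<beta> where \<beta>: "\<And>j y. j \<in> {1..n} \<Longrightarrow> norm (grad (f j) y - m *\<^sub>R y) \<le> \<beta>"
      and M: "M = mat22 (- m\<^sup>2) m m (- 1)" and G: "G\<^sup>2 = \<beta>\<^sup>2 + m\<^sup>2 * (norm z)\<^sup>2"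
      unfolding case_I_def by blast
    have "(norm (grad (f j) y))\<^sup>2
        \<le> - m\<^sup>2 * (norm (y - z))\<^sup>2 + 2 * m * ((y - z) \<bullet> (grad (f j) y - 0)) + 2 * G\<^sup>2"
      if j: "j \<in> {1..n}" for j
    proof -
      let ?u = "grad (f j) y"
      \<comment> \<open>Case I compares the gradient with \<open>m y\<close>; recentring at
        \<open>z\<close> costs \<open>m z\<close>, hence the term with \<open>norm z\<close> in
        \<open>G\<close>. Expanding the left side produces the entries of \<open>M\<close>.\<close>
      have "(norm (?u - m *\<^sub>R (y - z)))\<^sup>2 \<le> 2 * (norm (?u - m *\<^sub>R y))\<^sup>2 + 2 * (norm (m *\<^sub>R z))\<^sup>2"
        using norm_sq_le_2_diff_sq[of "?u - m *\<^sub>R (y - z)" "m *\<^sub>R z"] by (simp add: algebra_simps)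
      also have "\<dots> \<le> 2 * \<beta>\<^sup>2 + 2 * (m\<^sup>2 * (norm z)\<^sup>2)"
        using power_mono[OF \<beta>[OF j, of y], of 2] by (simp add: power_mult_distrib)
      finally have "(norm (?u - m *\<^sub>R (y - z)))\<^sup>2 \<le> 2 * G\<^sup>2"
        using G by simp
      moreover have "(norm (?u - m *\<^sub>R (y - z)))\<^sup>2
          = (norm ?u)\<^sup>2 - 2 * m * ((y - z) \<bullet> ?u) + m\<^sup>2 * (norm (y - z))\<^sup>2"
        unfolding power2_norm_eq_inner
        by (simp add: inner_diff_left inner_diff_right inner_commute power2_eq_square algebra_simps)
      ultimately show ?thesis by simp
    qed
    from pointwise[where v = "\<lambda>_. 0" and w = "\<lambda>_. G\<^sup>2", OF _ _ this] show ?thesis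
      using n by (simp add: M)
  next
    assume "case_II n f z M G"
    then obtain L where L: "\<And>j. j \<in> {1..n} \<Longrightarrow> L_smooth L (f j)"
      and M: "M = mat22 (2 * L\<^sup>2) 0 0 (- 1)"
      and G: "G\<^sup>2 = (1 / real n) * (\<Sum>j=1..n. (norm (grad (f j) z))\<^sup>2)"
      unfolding case_II_def by blast
    have "(norm (grad (f j) y))\<^sup>2
        \<le> 2 * L\<^sup>2 * (norm (y - z))\<^sup>2 + 2 * 0 * ((y - z) \<bullet> (grad (f j) y - grad (f j) z))
          + 2 * (norm (grad (f j) z))\<^sup>2"
      if j: "j \<in> {1..n}" for j
    proof -
      have "norm (grad (f j) y - grad (f j) z) \<le> L * norm (y - z)"
        using L[OF j] unfolding L_smooth_def by blast
      from power_mono[OF this, of 2] show ?thesis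
        using split[of j] by (simp add: power_mult_distrib)
    qed
    from pointwise[OF _ sum0 this] show ?thesis
      by (simp add: M G)
  next
    assume "case_III n f z M G"
    then obtain L where L: "\<And>j. j \<in> {1..n} \<Longrightarrow> f j \<in> class_F 0 L"
      and M: "M = mat22 0 L L (- 1)"
      and G: "G\<^sup>2 = (1 / real n) * (\<Sum>j=1..n. (norm (grad (f j) z))\<^sup>2)"
      unfolding case_III_def by blast
    have "(norm (grad (f j) y))\<^sup>2
        \<le> 0 * (norm (y - z))\<^sup>2 + 2 * L * ((y - z) \<bullet> (grad (f j) y - grad (f j) z))
          + 2 * (norm (grad (f j) z))\<^sup>2"
      if j: "j \<in> {1..n}" for j
      using class_F_cocoercive[OF L[OF j], of y z] split[of j] by simp
    from pointwise[OF _ sum0 this] show ?thesis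
      by (simp add: M G)
  next
    assume "case_IV n f m z M G"
    then obtain L where L: "\<And>j. j \<in> {1..n} \<Longrightarrow> f j \<in> class_F m L"
      and M: "M = mat22 (- 2 * m * L) (L + m) (L + m) (- 1)"
      and G: "G\<^sup>2 = (1 / real n) * (\<Sum>j=1..n. (norm (grad (f j) z))\<^sup>2)"
      unfolding case_IV_def by blast
    have "(norm (grad (f j) y))\<^sup>2
        \<le> - 2 * m * L * (norm (y - z))\<^sup>2 + 2 * (L + m) * ((y - z) \<bullet> (grad (f j) y - grad (f j) z))
          + 2 * (norm (grad (f j) z))\<^sup>2"
      if j: "j \<in> {1..n}" for j
      using class_F_cocoercive[OF L[OF j], of y z] split[of j] by (simp add: algebra_simps)
    from pointwise[OF _ sum0 this] show ?thesis
      by (simp add: M G)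
  qed
qed

section \<open>Symmetry of \<open>M\<close> and the lower bound on \<open>M_tilde\<close>\<close>

lemma M_offdiag_eq:
  assumes "case_I n f m z M G \<or> case_II n f z M G \<or> case_III n f z M G \<or> case_IV n f m z M G"
  shows "M $ 2 $ 1 = M $ 1 $ 2"
  using assms unfolding case_I_def case_II_def case_III_def case_IV_def by auto

text \<open>At distance one from \<open>z\<close>, strong monotonicity makes the mean gradient at
  least \<open>m\<close> in norm, while the Lipschitz bounds and stationarity make it at most
  \<open>L\<close>.\<close>

lemma strong_monotone_le_smooth:
  fixes f :: "nat \<Rightarrow> 'a::euclidean_space \<Rightarrow> real"
  assumes n: "n \<ge> 1" and diff: "\<And>j y. j \<in> {1..n} \<Longrightarrow> f j differentiable (at y)"
    and stat: "grad (avg n f) z = 0"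
    and mono: "\<And>y. (y - z) \<bullet> grad (avg n f) y \<ge> m * (norm (y - z))\<^sup>2"
    and smooth: "\<And>j y. j \<in> {1..n} \<Longrightarrow> norm (grad (f j) y - grad (f j) z) \<le> L * norm (y - z)"
  shows "m \<le> L"
proof -
  have grad: "grad (avg n f) x = (1 / real n) *\<^sub>R (\<Sum>j=1..n. grad (f j) x)" for x
    using diff by (rule grad_avg)
  obtain b :: 'a where b: "norm b = 1"
    using norm_Basis nonempty_Basis by blast
  have "norm (\<Sum>j=1..n. grad (f j) (z + b) - grad (f j) z) \<le> (\<Sum>j=1..n. L)"
    using smooth[of _ "z + b"] b by (intro sum_norm_le) simp
  then have "norm (real n *\<^sub>R (grad (avg n f) (z + b) - grad (avg n f) z)) \<le> real n * L"
    using n unfolding grad by (simp add: scaleR_diff_right sum_subtractf)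
  then have "norm (grad (avg n f) (z + b)) \<le> L"
    using n stat by simp
  moreover have "m \<le> b \<bullet> grad (avg n f) (z + b)"
    using mono[of "z + b"] b by simp
  moreover have "b \<bullet> grad (avg n f) (z + b) \<le> norm (grad (avg n f) (z + b))"
    using norm_cauchy_schwarz[of b "grad (avg n f) (z + b)"] b by simp
  ultimately show ?thesis by linarith
qed

text \<open>Needed for the claim on small stepsizes. \<open>M_tilde\<close> equals
  \<open>m\<^sup>2\<close>, \<open>2 * L\<^sup>2\<close>, \<open>2 * m * L\<close> and
  \<open>2 * m\<^sup>2\<close> in cases I to IV; the two middle values call for
  \<open>m \<le> L\<close>.\<close>

lemma M_tilde_ge:
  fixes f :: "nat \<Rightarrow> 'a::euclidean_space \<Rightarrow> real"
  assumes n: "n \<ge> 1" and diff: "\<And>j y. j \<in> {1..n} \<Longrightarrow> f j differentiable (at y)"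
    and "m > 0" and stat: "grad (avg n f) z = 0"
    and mono: "\<And>y. (y - z) \<bullet> grad (avg n f) y \<ge> m * (norm (y - z))\<^sup>2"
    and cases: "case_I n f m z M G \<or> case_II n f z M G \<or> case_III n f z M G \<or> case_IV n f m z M G"
  shows "M_tilde m M \<ge> m\<^sup>2"
proof -
  note le_L = strong_monotone_le_smooth[OF n diff stat mono]
  from cases show ?thesis
  proof (elim disjE)
    assume "case_I n f m z M G"
    then show ?thesis
      unfolding case_I_def M_tilde_def by (auto simp: power2_eq_square)
  next
    assume "case_II n f z M G"
    then obtain L where L: "\<And>j. j \<in> {1..n} \<Longrightarrow> L_smooth L (f j)"
      and M: "M = mat22 (2 * L\<^sup>2) 0 0 (- 1)"
      unfolding case_II_def by blast
    have "m \<le> L"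
      using L by (intro le_L) (auto simp: L_smooth_def)
    then have "m\<^sup>2 \<le> L\<^sup>2"
      using \<open>m > 0\<close> by (intro power_mono) auto
    then show ?thesis
      using zero_le_power2[of L] unfolding M M_tilde_def mat22_nth by linarith
  next
    assume "case_III n f z M G"
    then obtain L where L: "\<And>j. j \<in> {1..n} \<Longrightarrow> f j \<in> class_F 0 L"
      and M: "M = mat22 0 L L (- 1)"
      unfolding case_III_def by blast
    have "m \<le> L"
    proof (rule le_L)
      fix j y assume j: "j \<in> {1..n}"
      let ?w = "grad (f j) y - grad (f j) z"
      have "L > 0" using L[OF j] unfolding class_F_def by simp
      \<comment> \<open>Cocoercivity and Cauchy-Schwarz give the Lipschitz bound after cancelling
        one factor \<open>norm ?w\<close>.\<close>
      have "(norm ?w)\<^sup>2 \<le> L * ((y - z) \<bullet> ?w)"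
        using class_F_cocoercive[OF L[OF j], of y z] by simp
      also have "\<dots> \<le> L * (norm (y - z) * norm ?w)"
        using \<open>L > 0\<close> norm_cauchy_schwarz by (intro mult_left_mono) auto
      finally have "norm ?w * norm ?w \<le> (L * norm (y - z)) * norm ?w"
        by (simp add: power2_eq_square mult.assoc)
      then show "norm ?w \<le> L * norm (y - z)"
        using \<open>L > 0\<close> by (cases "norm ?w = 0") (auto simp: mult_le_cancel_right)
    qed
    then have "m * m \<le> m * L"
      using \<open>m > 0\<close> by (intro mult_left_mono) auto
    moreover have "0 < m * m"
      using \<open>m > 0\<close> by simp
    ultimately have "m\<^sup>2 \<le> 2 * (m * L)"
      unfolding power2_eq_square by linarith
    then show ?thesis
      unfolding M M_tilde_def by simp
  next
    assume "case_IV n f m z M G"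
    then show ?thesis
      unfolding case_IV_def M_tilde_def by (auto simp: power2_eq_square algebra_simps)
  qed
qed

section \<open>One biased step and its average over the index\<close>

lemma norm_add_sq_le_weighted:
  fixes a b :: "'a::real_inner"
  assumes "t > 0"
  shows "(norm (a + b))\<^sup>2 \<le> (1 + t) * (norm a)\<^sup>2 + (1 + 1 / t) * (norm b)\<^sup>2"
proof -
  \<comment> \<open>This quotient is the exact slack in Young's inequality.\<close>
  have "0 \<le> (norm (t *\<^sub>R a - b))\<^sup>2 / t"
    using assms by simp
  also have "(norm (t *\<^sub>R a - b))\<^sup>2 / t
      = ((1 + t) * (norm a)\<^sup>2 + (1 + 1 / t) * (norm b)\<^sup>2) - (norm (a + b))\<^sup>2"
    using assms unfolding power2_norm_eq_inner
    by (simp add: inner_diff_left inner_diff_right inner_add_left inner_add_right inner_commute field_simps)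
  finally show ?thesis by simp
qed

text \<open>Young's inequality with weight \<open>t = m * \<alpha>\<close> separates the error from the exact step
  and makes everything else proportional to \<open>1 + m * \<alpha>\<close>.\<close>

definition step_bound :: "real \<Rightarrow> real \<Rightarrow> real \<Rightarrow> real \<Rightarrow> 'a::real_inner \<Rightarrow> 'a \<Rightarrow> real" where
  "step_bound m \<alpha> \<delta> c d u = (1 + m * \<alpha>) * ((norm d)\<^sup>2 - 2 * \<alpha> * (d \<bullet> u)
     + \<alpha> / m * (m * \<alpha> + \<delta>\<^sup>2) * (norm u)\<^sup>2 + \<alpha> / m * c\<^sup>2)"

lemma biased_step_le:
  fixes d u e :: "'a::real_inner"
  assumes "m > 0" "\<alpha> > 0" and e: "(norm e)\<^sup>2 \<le> \<delta>\<^sup>2 * (norm u)\<^sup>2 + c\<^sup>2"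
  shows "(norm (d - \<alpha> *\<^sub>R (u + e)))\<^sup>2 \<le> step_bound m \<alpha> \<delta> c d u"
proof -
  have "(norm (d - \<alpha> *\<^sub>R (u + e)))\<^sup>2 = (norm ((d - \<alpha> *\<^sub>R u) + (- \<alpha>) *\<^sub>R e))\<^sup>2"
    by (simp add: algebra_simps)
  also have "\<dots> \<le> (1 + m * \<alpha>) * (norm (d - \<alpha> *\<^sub>R u))\<^sup>2
      + (1 + 1 / (m * \<alpha>)) * (norm ((- \<alpha>) *\<^sub>R e))\<^sup>2"
    using assms by (intro norm_add_sq_le_weighted) auto
  also have "\<dots> = (1 + m * \<alpha>) * ((norm (d - \<alpha> *\<^sub>R u))\<^sup>2 + \<alpha> / m * (norm e)\<^sup>2)"
    using assms by (simp add: power_mult_distrib field_simps power2_eq_square)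
  also have "\<dots> \<le> (1 + m * \<alpha>) * ((norm (d - \<alpha> *\<^sub>R u))\<^sup>2 + \<alpha> / m * (\<delta>\<^sup>2 * (norm u)\<^sup>2 + c\<^sup>2))"
    using assms by (intro mult_left_mono add_left_mono e) auto
  also have "(norm (d - \<alpha> *\<^sub>R u))\<^sup>2 = (norm d)\<^sup>2 - 2 * \<alpha> * (d \<bullet> u) + \<alpha>\<^sup>2 * (norm u)\<^sup>2"
    unfolding power2_norm_eq_inner
    by (simp add: inner_diff_left inner_diff_right inner_commute power2_eq_square algebra_simps)
  also have "(1 + m * \<alpha>) * ((norm d)\<^sup>2 - 2 * \<alpha> * (d \<bullet> u) + \<alpha>\<^sup>2 * (norm u)\<^sup>2
      + \<alpha> / m * (\<delta>\<^sup>2 * (norm u)\<^sup>2 + c\<^sup>2)) = step_bound m \<alpha> \<delta> c d u"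
    using \<open>m > 0\<close> unfolding step_bound_def by (simp add: field_simps power2_eq_square)
  finally show ?thesis .
qed

text \<open>The error 0 is admissible, so the bound dominates a square. Nonnegativity allows sums of
  such bounds to be moved into \<open>ennreal\<close>.\<close>

lemma step_bound_nonneg:
  assumes "m > 0" "\<alpha> > 0"
  shows "0 \<le> step_bound m \<alpha> \<delta> c d u"
  using biased_step_le[OF assms, of 0 \<delta> u c d] by (rule order_trans[rotated]) simp_all

text \<open>The first factor comes from Young's inequality; the second is the coefficient of
  \<open>|d|\<^sup>2\<close> once \<open>\<langle>d, \<nabla>g\<rangle>\<close> has been replaced by
  \<open>m |d|\<^sup>2\<close>.\<close>

lemma rho_sq_factor:
  assumes "m \<noteq> 0"
  shows "rho_sq m Mt \<delta> \<alpha> = (1 + m * \<alpha>) * (1 - 2 * m * \<alpha> + \<alpha> / m * (m * \<alpha> + \<delta>\<^sup>2) * Mt)"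
  using assms unfolding rho_sq_def by (simp add: field_simps power2_eq_square power3_eq_cube)

text \<open>Identifies \<open>U_star\<close> with the constant term of the averaged step divided by
  \<open>1 - rho_sq\<close>; the common factor \<alpha>\<open>/ m\<close> cancels.\<close>

lemma U_star_eq:
  assumes "m \<noteq> 0" "\<alpha> \<noteq> 0"
  shows "U_star m Mt G \<delta> c \<alpha>
    = \<alpha> / m * (1 + m * \<alpha>) * (2 * G\<^sup>2 * (m * \<alpha> + \<delta>\<^sup>2) + c\<^sup>2) / (1 - rho_sq m Mt \<delta> \<alpha>)"
proof -
  have "1 - rho_sq m Mt \<delta> \<alpha>
      = \<alpha> / m * ((m\<^sup>2 - Mt * \<delta>\<^sup>2) - m * (Mt * (1 + \<delta>\<^sup>2) - 2 * m\<^sup>2) * \<alpha> - Mt * m\<^sup>2 * \<alpha>\<^sup>2)"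
    using assms unfolding rho_sq_def by (simp add: field_simps power2_eq_square power3_eq_cube)
  moreover have "(1 + m * \<alpha>) * (2 * G\<^sup>2 * (m * \<alpha> + \<delta>\<^sup>2) + c\<^sup>2)
      = 2 * \<delta>\<^sup>2 * G\<^sup>2 + c\<^sup>2 + m * (c\<^sup>2 + 2 * G\<^sup>2 * (1 + \<delta>\<^sup>2)) * \<alpha> + 2 * m\<^sup>2 * G\<^sup>2 * \<alpha>\<^sup>2"
    by (simp add: algebra_simps power2_eq_square)
  ultimately show ?thesis
    using assms unfolding U_star_def by (simp add: mult.assoc)
qed

lemma mean_step_bound_le:
  fixes u :: "nat \<Rightarrow> 'a::real_inner" and M :: "real^2^2"
  assumes n: "n \<ge> 1" and "m > 0" "\<alpha> > 0"
    and step: "M $ 1 $ 2 * (\<alpha> + \<delta>\<^sup>2 / m) \<le> 1"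
    and mono: "m * (norm d)\<^sup>2 \<le> d \<bullet> q" and q: "q = (1 / real n) *\<^sub>R (\<Sum>j=1..n. u j)"
    and sq: "(1 / real n) * (\<Sum>j=1..n. (norm (u j))\<^sup>2)
      \<le> M $ 1 $ 1 * (norm d)\<^sup>2 + 2 * M $ 1 $ 2 * (d \<bullet> q) + 2 * G\<^sup>2"
  shows "(1 / real n) * (\<Sum>j=1..n. step_bound m \<alpha> \<delta> c d (u j))
    \<le> rho_sq m (M_tilde m M) \<delta> \<alpha> * (norm d)\<^sup>2
      + \<alpha> / m * (1 + m * \<alpha>) * (2 * G\<^sup>2 * (m * \<alpha> + \<delta>\<^sup>2) + c\<^sup>2)"
proof -
  \<comment> \<open>The coefficient of the squared gradient norm inside
    \<open>step_bound\<close>.\<close>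
  define K where "K = \<alpha> / m * (m * \<alpha> + \<delta>\<^sup>2)"
  define D where "D = (norm d)\<^sup>2"
  define S where "S = (1 / real n) * (\<Sum>j=1..n. (norm (u j))\<^sup>2)"
  have "K \<ge> 0"
    using assms unfolding K_def by simp
  have dq: "d \<bullet> q = (1 / real n) * (\<Sum>j=1..n. d \<bullet> u j)"
    by (simp add: q inner_sum_right)
  have "(\<Sum>j=1..n. step_bound m \<alpha> \<delta> c d (u j))
      = (1 + m * \<alpha>) * (real n * D - 2 * \<alpha> * (\<Sum>j=1..n. d \<bullet> u j)
        + K * (\<Sum>j=1..n. (norm (u j))\<^sup>2) + real n * (\<alpha> / m * c\<^sup>2))"
    unfolding step_bound_def K_def[symmetric] D_def[symmetric]
    by (simp add: sum.distrib sum_subtractf sum_distrib_left[symmetric])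
  then have "(1 / real n) * (\<Sum>j=1..n. step_bound m \<alpha> \<delta> c d (u j))
      = (1 + m * \<alpha>) * (D - 2 * \<alpha> * (d \<bullet> q) + K * S + \<alpha> / m * c\<^sup>2)"
    using n unfolding dq S_def by (simp add: field_simps)
  also have "\<dots> \<le> (1 + m * \<alpha>) * (D * (1 - 2 * m * \<alpha> + K * M_tilde m M) + K * (2 * G\<^sup>2) + \<alpha> / m * c\<^sup>2)"
  proof (rule mult_left_mono)
    have "K * S \<le> K * (M $ 1 $ 1 * D + 2 * M $ 1 $ 2 * (d \<bullet> q) + 2 * G\<^sup>2)"
      using sq \<open>K \<ge> 0\<close> unfolding S_def D_def by (rule mult_left_mono)
    \<comment> \<open>Adding this product to the upper bound cancels every
      \<open>d \<bullet> q\<close> and leaves \<open>m * D\<close> in its place, which merges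
      \<open>M $ 1 $ 1\<close> and \<open>2 * m * M $ 1 $ 2\<close> into
      \<open>M_tilde\<close>.\<close>
    moreover have "2 * (\<alpha> - M $ 1 $ 2 * K) * (d \<bullet> q - m * D) \<ge> 0"
    proof -
      have "\<alpha> - M $ 1 $ 2 * K = \<alpha> * (1 - M $ 1 $ 2 * (\<alpha> + \<delta>\<^sup>2 / m))"
        using \<open>m > 0\<close> unfolding K_def by (simp add: field_simps)
      then show ?thesis
        using step mono \<open>\<alpha> > 0\<close> unfolding D_def by simp
    qed
    ultimately show "D - 2 * \<alpha> * (d \<bullet> q) + K * S + \<alpha> / m * c\<^sup>2
        \<le> D * (1 - 2 * m * \<alpha> + K * M_tilde m M) + K * (2 * G\<^sup>2) + \<alpha> / m * c\<^sup>2"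
      unfolding M_tilde_def by (simp add: algebra_simps)
  qed (use assms in simp)
  also have "\<dots> = (1 + m * \<alpha>) * (1 - 2 * m * \<alpha> + K * M_tilde m M) * D
      + (1 + m * \<alpha>) * (K * (2 * G\<^sup>2) + \<alpha> / m * c\<^sup>2)"
    by (simp only: distrib_left mult_ac add.assoc)
  also have "(1 + m * \<alpha>) * (1 - 2 * m * \<alpha> + K * M_tilde m M) = rho_sq m (M_tilde m M) \<delta> \<alpha>"
    using \<open>m > 0\<close> by (simp add: rho_sq_factor K_def)
  also have "(1 + m * \<alpha>) * (K * (2 * G\<^sup>2) + \<alpha> / m * c\<^sup>2)
      = \<alpha> / m * (1 + m * \<alpha>) * (2 * G\<^sup>2 * (m * \<alpha> + \<delta>\<^sup>2) + c\<^sup>2)"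
    unfolding K_def by (simp only: distrib_left distrib_right mult_ac)
  finally show ?thesis
    unfolding D_def .
qed

section \<open>The affine recursion and small stepsizes\<close>

lemma ennreal_affine_recursion:
  fixes E :: "nat \<Rightarrow> ennreal" and r s :: real
  assumes "0 \<le> r" "r < 1" "0 \<le> s"
    and step: "\<And>k. E (Suc k) \<le> ennreal r * E k + ennreal s"
  shows "E k \<le> ennreal (r ^ k) * E 0 + ennreal (s / (1 - r))"
proof (induction k)
  case 0
  show ?case by simp
next
  case (Suc k)
  have "E (Suc k) \<le> ennreal r * (ennreal (r ^ k) * E 0 + ennreal (s / (1 - r))) + ennreal s"
    using step[of k] Suc.IH by (meson add_right_mono mult_left_mono order_trans zero_le)
  also have "\<dots> = ennreal (r ^ Suc k) * E 0 + (ennreal (r * (s / (1 - r))) + ennreal s)"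
    using assms by (subst ennreal_mult) (auto simp: distrib_left ennreal_mult mult.assoc add.assoc)
  also have "ennreal (r * (s / (1 - r))) + ennreal s = ennreal (r * (s / (1 - r)) + s)"
    using assms by (intro ennreal_plus[symmetric]) auto
  \<comment> \<open>The additive term is the fixed point of the recursion, so it reproduces
    itself.\<close>
  also have "r * (s / (1 - r)) + s = s / (1 - r)"
    using assms by (simp add: field_simps)
  finally show ?case .
qed

text \<open>The hypothesis \<open>Mt \<ge> m\<^sup>2\<close> is what lets \<open>rho_sq < 1\<close> at one positive
  stepsize force the slope of \<open>rho_sq\<close> at \<open>0\<close> to be negative.\<close>

lemma rho_sq_eventually_in_unit_interval:
  assumes "m > 0" "\<alpha> > 0" and Mt: "Mt \<ge> m\<^sup>2" and lt: "rho_sq m Mt \<delta> \<alpha> < 1"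
  shows "\<forall>\<^sub>F a in at_right 0. 0 < rho_sq m Mt \<delta> a \<and> rho_sq m Mt \<delta> a < 1"
proof -
  \<comment> \<open>\<open>Q\<close> is the difference quotient of \<open>rho_sq\<close> at 0, so
    \<open>Q 0\<close> is the slope there, and for \<open>a > 0\<close> the condition
    \<open>rho_sq < 1\<close> means \<open>Q a < 0\<close>.\<close>
  define Q where "Q a = (Mt * (1 + \<delta>\<^sup>2) - 2 * m\<^sup>2) * a + Mt * m * a\<^sup>2 - (m\<^sup>2 - Mt * \<delta>\<^sup>2) / m" for a
  have rho: "rho_sq m Mt \<delta> a = 1 + a * Q a" for a
    unfolding rho_sq_def Q_def by (simp add: algebra_simps power2_eq_square power3_eq_cube)
  have "Q \<alpha> < 0"
    using lt \<open>\<alpha> > 0\<close> unfolding rho by (simp add: mult_less_0_iff)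
  \<comment> \<open>The second summand is nonnegative by \<open>Mt \<ge> m\<^sup>2\<close>, so the
    first must be negative, which is the sign of \<open>Q 0\<close>.\<close>
  moreover have "m * Q \<alpha> = (Mt * \<delta>\<^sup>2 - m\<^sup>2) * (1 + m * \<alpha>) + (Mt * (1 + m * \<alpha>) - m\<^sup>2) * (m * \<alpha>)"
    using \<open>m > 0\<close> unfolding Q_def by (simp add: field_simps power2_eq_square)
  moreover have "(Mt * (1 + m * \<alpha>) - m\<^sup>2) * (m * \<alpha>) \<ge> 0"
  proof -
    have "Mt * 1 \<le> Mt * (1 + m * \<alpha>)"
      using Mt \<open>m > 0\<close> \<open>\<alpha> > 0\<close> by (intro mult_left_mono) (auto intro: order_trans[OF zero_le_power2])
    then show ?thesis
      using Mt \<open>m > 0\<close> \<open>\<alpha> > 0\<close> by (intro mult_nonneg_nonneg) auto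
  qed
  ultimately have "(Mt * \<delta>\<^sup>2 - m\<^sup>2) * (1 + m * \<alpha>) < 0"
    using mult_pos_neg[of m "Q \<alpha>"] \<open>m > 0\<close> by linarith
  moreover have "0 < 1 + m * \<alpha>"
    using \<open>m > 0\<close> \<open>\<alpha> > 0\<close> by (simp add: add_pos_pos)
  ultimately have "Mt * \<delta>\<^sup>2 - m\<^sup>2 < 0"
    by (simp add: mult_less_0_iff)
  then have Q0: "Q 0 < 0"
    using \<open>m > 0\<close> unfolding Q_def by (simp add: field_simps)
  have "(Q \<longlongrightarrow> Q 0) (at_right 0)"
    using \<open>m > 0\<close> unfolding Q_def by (auto intro!: tendsto_eq_intros)
  then have "\<forall>\<^sub>F a in at_right 0. Q a < 0"
    using Q0 by (rule order_tendstoD)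
  moreover have "((\<lambda>a. rho_sq m Mt \<delta> a) \<longlongrightarrow> 1) (at_right 0)"
    using \<open>m > 0\<close> unfolding rho_sq_def by (auto intro!: tendsto_eq_intros)
  then have "\<forall>\<^sub>F a in at_right 0. 0 < rho_sq m Mt \<delta> a"
    by (rule order_tendstoD) simp
  moreover have "\<forall>\<^sub>F a in at_right (0::real). 0 < a"
    by (rule eventually_at_right_less)
  ultimately show ?thesis
    by eventually_elim (simp add: rho mult_pos_neg)
qed

section \<open>The expected recursion for the iterates\<close>

theorem corollary3:
  fixes P :: "'w measure"
    and n :: nat
    and f :: "nat \<Rightarrow> real^'p \<Rightarrow> real"
    and m \<alpha> \<delta> c G :: real
    and M :: "real^2^2"
    and xs :: "real^'p"
    and i :: "nat \<Rightarrow> 'w \<Rightarrow> nat"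
    and e x :: "nat \<Rightarrow> 'w \<Rightarrow> real^'p"
  assumes "prob_space P"
    and "n \<ge> 1"
    and "\<forall>j\<in>{1..n}. \<forall>y. f j differentiable (at y)"
    and "m > 0"
    and "avg n f \<in> class_S m"
    and "\<forall>y. avg n f xs \<le> avg n f y"
    and "case_I n f m xs M G \<or> case_II n f xs M G \<or> case_III n f xs M G \<or> case_IV n f m xs M G"
    and "\<delta> \<ge> 0" and "c \<ge> 0"
    and "\<alpha> > 0"
    and "prob_space.biased_sgd P n f \<delta> c (\<lambda>_. \<alpha>) i e x"
    and "M $ 2 $ 1 * (\<alpha> + \<delta>\<^sup>2 / m) \<le> 1"
    and "0 < rho_sq m (M_tilde m M) \<delta> \<alpha>" and "rho_sq m (M_tilde m M) \<delta> \<alpha> < 1"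
  shows "(\<forall>k. (\<integral>\<^sup>+\<omega>. ennreal ((norm (x k \<omega> - xs))\<^sup>2) \<partial>P)
            \<le> ennreal (rho_sq m (M_tilde m M) \<delta> \<alpha> ^ k)
                * (\<integral>\<^sup>+\<omega>. ennreal ((norm (x 0 \<omega> - xs))\<^sup>2) \<partial>P)
              + ennreal (U_star m (M_tilde m M) G \<delta> c \<alpha>))
       \<and> (\<forall>\<^sub>F a in at_right 0.
            0 < rho_sq m (M_tilde m M) \<delta> a \<and> rho_sq m (M_tilde m M) \<delta> a < 1)"
proof -
  interpret prob_space P by fact
  have diff: "f j differentiable (at y)" if "j \<in> {1..n}" for j y
    using assms(3) that by blast
  have stat: "grad (avg n f) xs = 0"
    using assms(5,6) by (intro grad_eq_0_at_minimum) (auto simp: class_S_def)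
  have mono: "(y - xs) \<bullet> grad (avg n f) y \<ge> m * (norm (y - xs))\<^sup>2" for y
    using assms(4-6) by (intro class_S_minimizer) auto
  define \<rho> where "\<rho> = rho_sq m (M_tilde m M) \<delta> \<alpha>"
  define s where "s = \<alpha> / m * (1 + m * \<alpha>) * (2 * G\<^sup>2 * (m * \<alpha> + \<delta>\<^sup>2) + c\<^sup>2)"
  define H where "H j y = step_bound m \<alpha> \<delta> c (y - xs) (grad (f j) y)" for j y
  have "s \<ge> 0"
    using \<open>m > 0\<close> \<open>\<alpha> > 0\<close> unfolding s_def by simp
  have H_nonneg: "H j y \<ge> 0" for j y
    using \<open>m > 0\<close> \<open>\<alpha> > 0\<close> unfolding H_def by (rule step_bound_nonneg)
  have H_meas: "(\<lambda>y. ennreal (H j y)) \<in> borel_measurable borel" if "j \<in> {1..n}" for j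
    using grad_borel_measurable[OF diff[OF that]]
    unfolding H_def step_bound_def by measurable
  have mean_H: "(1 / real n) * (\<Sum>j=1..n. H j y) \<le> \<rho> * (norm (y - xs))\<^sup>2 + s" for y
    unfolding H_def \<rho>_def s_def
  proof (rule mean_step_bound_le[where q = "grad (avg n f) y"])
    show "M $ 1 $ 2 * (\<alpha> + \<delta>\<^sup>2 / m) \<le> 1"
      using assms(12) M_offdiag_eq[OF assms(7)] by simp
    show "grad (avg n f) y = (1 / real n) *\<^sub>R (\<Sum>j=1..n. grad (f j) y)"
      using diff by (rule grad_avg)
    show "(1 / real n) * (\<Sum>j=1..n. (norm (grad (f j) y))\<^sup>2)
        \<le> M $ 1 $ 1 * (norm (y - xs))\<^sup>2 + 2 * M $ 1 $ 2 * ((y - xs) \<bullet> grad (avg n f) y) + 2 * G\<^sup>2"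
      using \<open>n \<ge> 1\<close> diff stat assms(7) by (rule mean_sq_grad_le)
  qed (use assms mono in auto)
  have x_meas [measurable]: "x k \<in> borel_measurable P"
    and ind: "indep_rvs (count_space {1..n}) (i k) borel (x k)"
    and unif: "distr P (count_space {1..n}) (i k) = uniform_count_measure {1..n}"
    and upd: "\<omega> \<in> space P \<Longrightarrow> x (Suc k) \<omega> = x k \<omega> - \<alpha> *\<^sub>R (grad (f (i k \<omega>)) (x k \<omega>) + e k \<omega>)"
    and err: "\<omega> \<in> space P \<Longrightarrow>
      (norm (e k \<omega>))\<^sup>2 \<le> \<delta>\<^sup>2 * (norm (grad (f (i k \<omega>)) (x k \<omega>)))\<^sup>2 + c\<^sup>2" for k \<omega>
    using assms(11) unfolding biased_sgd_def Let_def by blast+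
  \<comment> \<open>With values in \<open>ennreal\<close> the recursion also covers an infinite
    initial second moment.\<close>
  define E where "E k = (\<integral>\<^sup>+\<omega>. ennreal ((norm (x k \<omega> - xs))\<^sup>2) \<partial>P)" for k
  have "E (Suc k) \<le> ennreal \<rho> * E k + ennreal s" for k
  proof -
    \<comment> \<open>The error is eliminated pointwise, before any independence is invoked, so
      \<open>e k\<close> may depend on \<open>i k\<close> and \<open>x k\<close> in any way.\<close>
    have "E (Suc k) \<le> (\<integral>\<^sup>+\<omega>. ennreal (H (i k \<omega>) (x k \<omega>)) \<partial>P)"
      unfolding E_def
    proof (intro nn_integral_mono ennreal_leI)
      fix \<omega> assume \<omega>: "\<omega> \<in> space P"
      have "x (Suc k) \<omega> - xs = (x k \<omega> - xs) - \<alpha> *\<^sub>R (grad (f (i k \<omega>)) (x k \<omega>) + e k \<omega>)"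
        using upd[OF \<omega>] by simp
      then show "(norm (x (Suc k) \<omega> - xs))\<^sup>2 \<le> H (i k \<omega>) (x k \<omega>)"
        unfolding H_def using biased_step_le[OF \<open>m > 0\<close> \<open>\<alpha> > 0\<close> err[OF \<omega>]] by (simp only:)
    qed
    also have "\<dots> = (\<integral>\<^sup>+\<omega>. ennreal (1 / real n) * (\<Sum>j=1..n. ennreal (H j (x k \<omega>))) \<partial>P)"
      using \<open>n \<ge> 1\<close> ind unif H_meas by (rule nn_integral_uniform_index)
    also have "\<dots> \<le> (\<integral>\<^sup>+\<omega>. ennreal \<rho> * ennreal ((norm (x k \<omega> - xs))\<^sup>2) + ennreal s \<partial>P)"
    proof (rule nn_integral_mono)
      fix \<omega>
      have "ennreal (1 / real n) * (\<Sum>j=1..n. ennreal (H j (x k \<omega>)))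
          = ennreal ((1 / real n) * (\<Sum>j=1..n. H j (x k \<omega>)))"
        using H_nonneg by (subst ennreal_mult) (simp_all add: sum_ennreal sum_nonneg)
      also have "\<dots> \<le> ennreal (\<rho> * (norm (x k \<omega> - xs))\<^sup>2 + s)"
        using mean_H by (rule ennreal_leI)
      also have "\<dots> = ennreal \<rho> * ennreal ((norm (x k \<omega> - xs))\<^sup>2) + ennreal s"
        using \<open>s \<ge> 0\<close> assms(13) unfolding \<rho>_def by (simp add: ennreal_mult)
      finally show "ennreal (1 / real n) * (\<Sum>j=1..n. ennreal (H j (x k \<omega>)))
          \<le> ennreal \<rho> * ennreal ((norm (x k \<omega> - xs))\<^sup>2) + ennreal s" .
    qed
    also have "\<dots> = ennreal \<rho> * E k + ennreal s"
      unfolding E_def by (simp add: nn_integral_add nn_integral_cmult emeasure_space_1)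
    finally show ?thesis .
  qed
  then have "E k \<le> ennreal (\<rho> ^ k) * E 0 + ennreal (s / (1 - \<rho>))" for k
    using assms(13,14) \<open>s \<ge> 0\<close> unfolding \<rho>_def by (intro ennreal_affine_recursion) auto
  moreover have "s / (1 - \<rho>) = U_star m (M_tilde m M) G \<delta> c \<alpha>"
    using \<open>m > 0\<close> \<open>\<alpha> > 0\<close> unfolding s_def \<rho>_def by (subst U_star_eq) auto
  moreover have "m\<^sup>2 \<le> M_tilde m M"
    using \<open>n \<ge> 1\<close> diff \<open>m > 0\<close> stat mono assms(7) by (rule M_tilde_ge)
  then have "\<forall>\<^sub>F a in at_right 0.
      0 < rho_sq m (M_tilde m M) \<delta> a \<and> rho_sq m (M_tilde m M) \<delta> a < 1"
    using rho_sq_eventually_in_unit_interval[OF \<open>m > 0\<close> \<open>\<alpha> > 0\<close>] assms(14) by blast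
  ultimately show ?thesis
    unfolding E_def \<rho>_def by simp
qed

end
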